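(* Fix positive integers $p,q$ such that $2 < \frac{p}{q} < 4$. Suppose a graph $G$ folds to a graph $H$. If $H$ is not $(p,q)$-mixing, then $G$ is not $(p,q)$-mixing. In particular, for $p = 2q+1$, a bipartite connected graph $G$ is $(p,q)$-mixing if and only if $G$ does not fold to the cycle $C_{4q+2}$.
   Context: Graphs are finite and simple. A $(p,q)$-colouring of $G$ is a map $f: V(G) \to \{0,1,\dots,p-1\}$ such that $q \leq |f(u)-f(v)| \leq p-q$ for every edge $uv$. $G$ is $(p,q)$-mixing if any two $(p,q)$-colourings of $G$ are joined by a finite sequence of $(p,q)$-colourings of $G$ in which consecutive colourings differ on at most one vertex (vacuously true if there are none). For vertices $x,y$ of $G$ at distance exactly $2$, let $G_{xy}$ be the (simple) graph obtained by identifying $x$ and $y$ into a new vertex $v_{xy}$; the homomorphism $G\to G_{xy}$ sending $x,y\mapsto v_{xy}$ and fixing all other vertices is an elementary fold. $G$ folds to $H$ if there is a homomorphism $f: G\to H$ which is a composition of (zero or more) elementary folds with $f(G)$ isomorphic to $H$. $C_n$ is the cycle on $n$ vertices. *)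

theory Defs
  imports "Graph_Theory.Graph_Theory" "HOL-Library.FuncSet"
begin

text \<open>
  A finite simple graph is a loopfree symmetric finite digraph without parallel arcs, i.e. an
  instance of the locale \<^locale>\<open>pair_graph\<close>: an edge \<open>uv\<close> is the pair of arcs \<open>(u, v)\<close>, \<open>(v, u)\<close>.
\<close>

definition colouring :: "nat \<Rightarrow> nat \<Rightarrow> 'a pair_pre_digraph \<Rightarrow> ('a \<Rightarrow> nat) \<Rightarrow> bool" where
  "colouring p q G f \<longleftrightarrow>
     f \<in> pverts G \<rightarrow>\<^sub>E {0..<p} \<and>
     (\<forall>(u, v) \<in> parcs G.
        int q \<le> \<bar>int (f u) - int (f v)\<bar> \<and> \<bar>int (f u) - int (f v)\<bar> \<le> int p - int q)"

definition recolouring_step ::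
  "nat \<Rightarrow> nat \<Rightarrow> 'a pair_pre_digraph \<Rightarrow> ('a \<Rightarrow> nat) \<Rightarrow> ('a \<Rightarrow> nat) \<Rightarrow> bool" where
  "recolouring_step p q G f g \<longleftrightarrow>
     colouring p q G f \<and> colouring p q G g \<and> card {v \<in> pverts G. f v \<noteq> g v} \<le> 1"

definition mixing :: "nat \<Rightarrow> nat \<Rightarrow> 'a pair_pre_digraph \<Rightarrow> bool" where
  "mixing p q G \<longleftrightarrow>
     (\<forall>f g. colouring p q G f \<longrightarrow> colouring p q G g \<longrightarrow> (recolouring_step p q G)\<^sup>*\<^sup>* f g)"

definition graph_distance :: "'a pair_pre_digraph \<Rightarrow> 'a \<Rightarrow> 'a \<Rightarrow> ereal" where
  "graph_distance G = wf_digraph.\<mu> (with_proj G) (\<lambda>_. 1)"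

definition graph_image :: "('a \<Rightarrow> 'b) \<Rightarrow> 'a pair_pre_digraph \<Rightarrow> 'b pair_pre_digraph" where
  "graph_image f G = \<lparr> pverts = f ` pverts G, parcs = map_prod f f ` parcs G \<rparr>"

text \<open>
  The vertex \<open>v\<^sub>x\<^sub>y\<close> obtained by identifying \<open>x\<close> and \<open>y\<close> is represented by \<open>x\<close>, so that the graph
  \<open>G\<^sub>x\<^sub>y\<close> has its vertices in the same type as \<open>G\<close>. This determines \<open>G\<^sub>x\<^sub>y\<close> up to isomorphism, which
  is all that \<open>folds_to\<close> below depends on.
\<close>

definition elementary_fold ::
  "('a \<Rightarrow> 'a) \<Rightarrow> 'a pair_pre_digraph \<Rightarrow> 'a pair_pre_digraph \<Rightarrow> bool" where
  "elementary_fold f G K \<longleftrightarrow>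
     (\<exists>x \<in> pverts G. \<exists>y \<in> pverts G.
        graph_distance G x y = 2 \<and> f = id(y := x) \<and> K = graph_image f G)"

inductive fold_composition ::
  "('a \<Rightarrow> 'a) \<Rightarrow> 'a pair_pre_digraph \<Rightarrow> 'a pair_pre_digraph \<Rightarrow> bool" where
  fold_id: "fold_composition id G G"
| fold_step: "fold_composition f G K \<Longrightarrow> elementary_fold g K L \<Longrightarrow> fold_composition (g \<circ> f) G L"

definition folds_to :: "'a pair_pre_digraph \<Rightarrow> 'b pair_pre_digraph \<Rightarrow> bool" where
  "folds_to G H \<longleftrightarrow>
     (\<exists>f K. fold_composition f G K \<and> digraph_iso (with_proj (graph_image f G)) (with_proj H))"

definition bipartite :: "'a pair_pre_digraph \<Rightarrow> bool" where
  "bipartite G \<longleftrightarrow>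
     (\<exists>A B. A \<union> B = pverts G \<and> A \<inter> B = {} \<and>
        (\<forall>(u, v) \<in> parcs G. (u \<in> A \<and> v \<in> B) \<or> (u \<in> B \<and> v \<in> A)))"

text \<open>This is the cycle on \<open>n\<close> vertices for \<open>n \<ge> 3\<close>.\<close>

definition cycle_graph :: "nat \<Rightarrow> nat pair_pre_digraph" where
  "cycle_graph n =
     \<lparr> pverts = {0..<n},
       parcs = {(i, j). i < n \<and> j < n \<and> (j = (i + 1) mod n \<or> i = (j + 1) mod n)} \<rparr>"

lemma graph_image_comp: "graph_image g (graph_image f G) = graph_image (g \<circ> f) G"
  unfolding graph_image_def by (simp add: image_comp map_prod.comp)

lemma fold_composition_image: "fold_composition f G K \<Longrightarrow> K = graph_image f G"
proof (induction rule: fold_composition.induct)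
  case (fold_id G)
  show ?case by (simp add: graph_image_def map_prod.id)
next
  case (fold_step f G K g L)
  have "L = graph_image g K" using fold_step.hyps(2) unfolding elementary_fold_def by blast
  then show ?case using fold_step.IH graph_image_comp by metis
qed

lemma graph_distance_2_iff:
  assumes "pair_graph G"
  shows "graph_distance G x y = 2 \<longleftrightarrow>
    x \<noteq> y \<and> (x, y) \<notin> parcs G \<and> (\<exists>z. (x, z) \<in> parcs G \<and> (z, y) \<in> parcs G)"
proof -
  interpret pair_graph G by fact
  have cost: "awalk_cost (\<lambda>_. 1) p = real (length p)" for p
    by (induction p) auto
  have dist: "graph_distance G x y = (INF p\<in>{p. awalk x p y}. ereal (real (length p)))"
    unfolding graph_distance_def \<mu>_def cost by simp
  let ?S = "{p. awalk x p y}"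
  have len0: "x = y" if "awalk x [] y" using that by (simp add: awalk_def)
  have len1: "(x, y) \<in> parcs G" if "awalk x [e] y" for e
    using that by (cases e) (auto simp: awalk_def)
  have len2: "\<exists>z. (x, z) \<in> parcs G \<and> (z, y) \<in> parcs G" if "awalk x [e, e'] y" for e e'
    using that by (cases e; cases e') (auto simp: awalk_def)
  have below: "graph_distance G x y \<le> real (length p)" if "awalk x p y" for p
    unfolding dist using that by (intro INF_lower2[of p]) auto
  show ?thesis
  proof
    assume d: "graph_distance G x y = 2"
    have ge: "2 \<le> length p" if "awalk x p y" for p
      using below[OF that] d by simp
    have "\<exists>p\<in>?S. ereal (real (length p)) < 3"
      using d unfolding dist INF_less_iff[symmetric] by simp
    then obtain p where p: "awalk x p y" "length p < 3" by auto
    with ge have "length p = 2" by force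
    then obtain e e' where "p = [e, e']" by (auto simp: length_Suc_conv numeral_2_eq_2)
    with p len2 have z: "\<exists>z. (x, z) \<in> parcs G \<and> (z, y) \<in> parcs G" by blast
    then have V: "x \<in> pverts G" "y \<in> pverts G" by (auto dest: in_arcsD1 in_arcsD2)
    have "x \<noteq> y" using ge[of "[]"] V by (auto simp: awalk_def)
    moreover have "(x, y) \<notin> parcs G" using ge[of "[(x, y)]"] V by (auto simp: awalk_def)
    ultimately show "x \<noteq> y \<and> (x, y) \<notin> parcs G \<and> (\<exists>z. (x, z) \<in> parcs G \<and> (z, y) \<in> parcs G)"
      using z by blast
  next
    assume a: "x \<noteq> y \<and> (x, y) \<notin> parcs G \<and> (\<exists>z. (x, z) \<in> parcs G \<and> (z, y) \<in> parcs G)"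
    then obtain z where z: "(x, z) \<in> parcs G" "(z, y) \<in> parcs G" by blast
    then have "awalk x [(x, z), (z, y)] y" by (auto simp: awalk_def dest: in_arcsD1)
    from below[OF this] have le: "graph_distance G x y \<le> 2" by simp
    have "2 \<le> length p" if "awalk x p y" for p
    proof (rule ccontr)
      assume "\<not> 2 \<le> length p"
      then consider "p = []" | e where "p = [e]"
        by (cases p; cases "tl p") auto
      then show False using that len0 len1 a by cases auto
    qed
    then have "2 \<le> graph_distance G x y"
      unfolding dist by (intro INF_greatest) auto
    with le show "graph_distance G x y = 2" by (rule antisym)
  qed
qed

lemma elementary_fold_pair_graph:
  assumes "pair_graph G" "elementary_fold f G K"
  shows "pair_graph K"
proof -
  interpret pair_graph G by fact
  obtain x y where xy: "graph_distance G x y = 2" and f: "f = id(y := x)" and K: "K = graph_image f G"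
    using assms(2) by (auto simp: elementary_fold_def)
  have na: "(x, y) \<notin> parcs G" using xy graph_distance_2_iff[OF assms(1)] by blast
  have s: "(v, u) \<in> parcs G" if "(u, v) \<in> parcs G" for u v
    using that sym_arcs by (simp add: arcs_ends_symmetric graph_symmetric)
  have loop: "f (fst e) \<noteq> f (snd e)" if "e \<in> parcs G" for e
    using that na s[of y x] pair_no_loops[OF that] by (cases e) (auto simp: f)
  show ?thesis
  proof
    fix e assume "e \<in> parcs K"
    then show "fst e \<in> pverts K" "snd e \<in> pverts K" "fst e \<noteq> snd e"
      using loop by (auto simp: K graph_image_def dest: in_arcsD1 in_arcsD2)
  next
    show "finite (pverts K)" "finite (parcs K)"
      using pair_finite_verts pair_finite_arcs by (auto simp: K graph_image_def)
    show "symmetric (with_proj K)"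
      using s by (force simp: K graph_image_def symmetric_def intro!: symI)
  qed
qed

end

theory Submission
  imports Defs
begin

text \<open>
  For \<open>2 < p/q < 4\<close> a graph is mixing iff every colouring has a potential, i.e. an integer function
  on the vertices whose increments are the centred colour changes along the arcs. One direction
  lifts a recolouring sequence from a colouring to its reflection; the other moves vertices one unit
  at a time in the order given by the potential. On \<open>G\<close>, a potential of a colouring pulled back from
  \<open>G\<^sub>x\<^sub>y\<close> takes the same value at \<open>x\<close> and \<open>y\<close>, because they have a common neighbour, so it
  descends to \<open>G\<^sub>x\<^sub>y\<close>. For \<open>p = 2q + 1\<close>, take a colouring without potential and identify
  equally coloured vertices at distance 2 as long as possible. What remains of a connected bipartite
  graph is a cycle whose length is divisible by \<open>p\<close> and by 2, and it folds further since
  the cycle of length \<open>n + 2\<close> folds to the cycle of length \<open>n\<close>.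
\<close>

section \<open>Turns and potentials\<close>

text \<open>The oriented distance from the colour of \<open>v\<close> to the colour of
  \<open>w\<close> on a circle of \<open>p\<close> colours. Unlike the absolute difference in
  \<open>colouring\<close> it keeps the direction, which is what winding is made of.\<close>

definition turn :: "nat \<Rightarrow> ('a \<Rightarrow> nat) \<Rightarrow> 'a \<Rightarrow> 'a \<Rightarrow> int" where
  "turn p f v w = (int (f w) - int (f v)) mod int p"

text \<open>
  The increment of a potential along an arc is twice the deviation of the colour change from \<open>p / 2\<close>,
  which is antisymmetric; for bipartite \<open>G\<close> a potential exists iff every cycle has winding number 0.
\<close>

definition potential :: "nat \<Rightarrow> 'a pair_pre_digraph \<Rightarrow> ('a \<Rightarrow> nat) \<Rightarrow> ('a \<Rightarrow> int) \<Rightarrow> bool" where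
  "potential p G f a \<longleftrightarrow> (\<forall>(v, w) \<in> parcs G. a w - a v = 2 * turn p f v w - int p)"

text \<open>The obstruction to mixing. An odd closed walk admits no potential: its turns would sum
  to an odd multiple of \<open>p / 2\<close>, while they telescope to a multiple of
  \<open>p\<close>. So on a nonbipartite graph every colouring is of this kind.\<close>

definition unliftable :: "nat \<Rightarrow> nat \<Rightarrow> 'a pair_pre_digraph \<Rightarrow> ('a \<Rightarrow> nat) \<Rightarrow> bool" where
  "unliftable p q G f \<longleftrightarrow> colouring p q G f \<and> (\<nexists>a. potential p G f a)"

text \<open>For \<open>y < x\<close> the residue is \<open>p - (x - y)\<close>, and the pair of
  bounds is symmetric under the exchange of t and \<open>p - t\<close>.\<close>

lemma circular_distance_iff:
  fixes x y p q :: int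
  assumes "0 < q" "0 \<le> x" "x < p" "0 \<le> y" "y < p"
  shows "q \<le> \<bar>x - y\<bar> \<and> \<bar>x - y\<bar> \<le> p - q \<longleftrightarrow> q \<le> (y - x) mod p \<and> (y - x) mod p \<le> p - q"
proof (cases "x \<le> y")
  case True
  then have "(y - x) mod p = y - x" using assms by (intro mod_pos_pos_trivial) auto
  then show ?thesis using True by auto
next
  case False
  have "(y - x) mod p = (y - x + p) mod p" by simp
  also have "\<dots> = y - x + p" using assms False by (intro mod_pos_pos_trivial) auto
  finally show ?thesis using False by auto
qed

lemma (in pair_wf_digraph) colouring_iff_turn:
  assumes "0 < q"
  shows "colouring p q G f \<longleftrightarrow> f \<in> pverts G \<rightarrow>\<^sub>E {0..<p} \<and>
    (\<forall>(u, v) \<in> parcs G. int q \<le> turn p f u v \<and> turn p f u v \<le> int p - int q)"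
proof -
  have "int q \<le> \<bar>int (f u) - int (f v)\<bar> \<and> \<bar>int (f u) - int (f v)\<bar> \<le> int p - int q \<longleftrightarrow>
      int q \<le> turn p f u v \<and> turn p f u v \<le> int p - int q"
    if "f \<in> pverts G \<rightarrow>\<^sub>E {0..<p}" "(u, v) \<in> parcs G" for u v
  proof -
    have "f u < p" "f v < p"
      using PiE_mem[OF that(1) in_arcsD1[OF that(2)]] PiE_mem[OF that(1) in_arcsD2[OF that(2)]] by auto
    then show ?thesis unfolding turn_def using assms by (intro circular_distance_iff) auto
  qed
  then show ?thesis unfolding colouring_def by fast
qed

lemma (in pair_wf_digraph) colouring_turn:
  assumes "0 < q" "colouring p q G f" "(u, v) \<in> parcs G"
  shows "int q \<le> turn p f u v" "turn p f u v \<le> int p - int q"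
  using assms colouring_iff_turn[OF assms(1)] by auto

lemma turn_swap:
  assumes "0 < turn p f u v"
  shows "turn p f v u = int p - turn p f u v"
proof -
  have "turn p f v u = (- (int (f v) - int (f u))) mod int p" by (simp add: turn_def)
  then show ?thesis using assms unfolding zmod_zminus1_eq_if by (simp add: turn_def)
qed

text \<open>Only one vertex \<open>z\<close> changes its colour, so only the turns at
  \<open>z\<close> change. All turns towards \<open>z\<close> change by the same integer
  \<open>d\<close>, hence \<open>D\<close> is \<open>d\<close> at \<open>z\<close> and 0 elsewhere;
  turns away from \<open>z\<close> follow by \<open>turn_swap\<close>.\<close>

lemma (in pair_graph) step_turn_difference:
  assumes "0 < q" "2 * q < p" "p < 4 * q" and step: "recolouring_step p q G f g"
  shows "\<exists>D. \<forall>(v, w) \<in> parcs G. turn p g v w = turn p f v w + D w - D v"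
proof -
  have f: "colouring p q G f" and g: "colouring p q G g" and c: "card {v \<in> pverts G. f v \<noteq> g v} \<le> 1"
    using step by (auto simp: recolouring_step_def)
  obtain z where z: "\<And>v. v \<in> pverts G \<Longrightarrow> v \<noteq> z \<Longrightarrow> f v = g v"
  proof (cases "{v \<in> pverts G. f v \<noteq> g v} = {}")
    case True
    then show ?thesis using that by blast
  next
    case False
    then have "card {v \<in> pverts G. f v \<noteq> g v} = 1"
      using c pair_finite_verts by (simp add: card_gt_0_iff Suc_leI le_antisym)
    then obtain z where "{v \<in> pverts G. f v \<noteq> g v} = {z}" by (rule card_1_singletonE)
    then show ?thesis using that by blast
  qed
  let ?d = "\<lambda>w. turn p g w z - turn p f w z"
  \<comment> \<open>Here \<open>p < 4q\<close> is needed: two congruent changes of size at most \<open>p - 2q < p / 2\<close> are equal.\<close>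
  have const: "?d w = ?d w'" if "(w, z) \<in> parcs G" "(w', z) \<in> parcs G" for w w'
  proof -
    have bd: "\<bar>?d w\<bar> \<le> int p - 2 * int q" if "(w, z) \<in> parcs G" for w
      using colouring_turn[OF assms(1) f that] colouring_turn[OF assms(1) g that] by linarith
    have md: "?d w mod int p = (int (g z) - int (f z)) mod int p" if "(w, z) \<in> parcs G" for w
    proof -
      have "f w = g w" using z that no_loops'[OF that] in_arcsD1 by blast
      then show ?thesis by (simp add: turn_def mod_simps)
    qed
    have "int p dvd ?d w - ?d w'" using md[OF that(1)] md[OF that(2)] by (metis mod_eq_dvd_iff)
    moreover have "\<bar>?d w - ?d w'\<bar> < int p"
      using bd[OF that(1)] bd[OF that(2)] assms(2,3) by linarith
    ultimately show ?thesis using zdvd_imp_le[of "int p" "\<bar>?d w - ?d w'\<bar>"] by (cases "?d w = ?d w'") auto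
  qed
  obtain d where d: "\<And>w. (w, z) \<in> parcs G \<Longrightarrow> turn p g w z = turn p f w z + d"
  proof (cases "\<exists>w. (w, z) \<in> parcs G")
    case True
    then obtain w where "(w, z) \<in> parcs G" by blast
    then have "turn p g w' z = turn p f w' z + ?d w" if "(w', z) \<in> parcs G" for w'
      using const[OF that \<open>(w, z) \<in> parcs G\<close>] by linarith
    then show ?thesis using that by blast
  next
    case False
    then show ?thesis using that by blast
  qed
  let ?D = "(\<lambda>_. 0 :: int)(z := d)"
  have "turn p g v w = turn p f v w + ?D w - ?D v" if e: "(v, w) \<in> parcs G" for v w
  proof -
    have "v \<noteq> w" using no_loops'[OF e] .
    consider "v \<noteq> z" "w \<noteq> z" | "w = z" | "v = z" by blast
    then show ?thesis
    proof cases
      case 1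
      then show ?thesis using z in_arcsD1[OF e] in_arcsD2[OF e] by (simp add: turn_def)
    next
      case 2
      then show ?thesis using d e \<open>v \<noteq> w\<close> by auto
    next
      case 3
      have e': "(w, z) \<in> parcs G" using arcs_symmetric[OF e] 3 by simp
      have "turn p g z w = int p - turn p g w z" "turn p f z w = int p - turn p f w z"
        using colouring_turn(1)[OF assms(1) f e'] colouring_turn(1)[OF assms(1) g e'] assms(1)
        by (intro turn_swap; linarith)+
      then show ?thesis using d[OF e'] 3 \<open>v \<noteq> w\<close> by simp
    qed
  qed
  then show ?thesis by blast
qed

text \<open>The \<open>D\<close> of the single steps add up. The sum is an integer and not a
  residue, so it does not forget full rounds of the colour circle.\<close>

lemma (in pair_graph) reachable_turn_difference:
  assumes "0 < q" "2 * q < p" "p < 4 * q" and "(recolouring_step p q G)\<^sup>*\<^sup>* f g"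
  shows "\<exists>D. \<forall>(v, w) \<in> parcs G. turn p g v w = turn p f v w + D w - D v"
  using assms(4)
proof (induction rule: rtranclp_induct)
  case base
  show ?case by (intro exI[of _ "\<lambda>_. 0"]) auto
next
  case (step g h)
  obtain D E where "\<forall>(v, w) \<in> parcs G. turn p g v w = turn p f v w + D w - D v"
    and "\<forall>(v, w) \<in> parcs G. turn p h v w = turn p g v w + E w - E v"
    using step.IH step_turn_difference[OF assms(1-3) step.hyps(2)] by blast
  then show ?case by (intro exI[of _ "\<lambda>v. D v + E v"]) fastforce
qed

text \<open>
  If \<open>f\<close> can be recoloured to its reflection \<open>p - 1 - f\<close>, every \<open>turn\<close> \<open>t\<close> has become \<open>p - t\<close>, so the
  accumulated colour changes form, up to sign, a potential.
\<close>

lemma (in pair_graph) mixing_imp_potential: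
  assumes "0 < q" "2 * q < p" "p < 4 * q" and "mixing p q G" and f: "colouring p q G f"
  shows "\<exists>a. potential p G f a"
proof -
  let ?g = "restrict (\<lambda>v. p - 1 - f v) (pverts G)"
  have fp: "f v < p" if "v \<in> pverts G" for v
    using f that by (auto simp: colouring_def dest: PiE_mem)
  have gf: "int (?g v) = int p - 1 - int (f v)" if "v \<in> pverts G" for v
    using fp[OF that] that by auto
  have "colouring p q G ?g"
    unfolding colouring_def
  proof (intro conjI)
    show "?g \<in> pverts G \<rightarrow>\<^sub>E {0..<p}" using assms(2) by auto
    show "\<forall>(u, v) \<in> parcs G. int q \<le> \<bar>int (?g u) - int (?g v)\<bar> \<and> \<bar>int (?g u) - int (?g v)\<bar> \<le> int p - int q"
    proof clarify
      fix u v assume e: "(u, v) \<in> parcs G"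
      have "int (?g u) - int (?g v) = int (f v) - int (f u)"
        using gf in_arcsD1[OF e] in_arcsD2[OF e] by simp
      then show "int q \<le> \<bar>int (?g u) - int (?g v)\<bar> \<and> \<bar>int (?g u) - int (?g v)\<bar> \<le> int p - int q"
        using f e unfolding colouring_def by (auto simp: abs_minus_commute)
    qed
  qed
  then have "(recolouring_step p q G)\<^sup>*\<^sup>* f ?g" using assms(4) f by (simp add: mixing_def)
  then obtain D where D: "\<forall>(v, w) \<in> parcs G. turn p ?g v w = turn p f v w + D w - D v"
    using reachable_turn_difference[OF assms(1-3)] by blast
  have "potential p G f (\<lambda>v. - D v)"
    unfolding potential_def
  proof clarify
    fix v w assume e: "(v, w) \<in> parcs G"
    have "turn p ?g v w = turn p f w v"
      using gf in_arcsD1[OF e] in_arcsD2[OF e] by (simp add: turn_def)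
    also have "\<dots> = int p - turn p f v w"
      using colouring_turn(1)[OF assms(1) f e] assms(1) by (intro turn_swap) linarith
    finally show "- D w - - D v = 2 * turn p f v w - int p" using D e by fastforce
  qed
  then show ?thesis by blast
qed

text \<open>Induction on the total displacement: the potential always provides a vertex that can
  move one unit towards its goal, after which \<open>f\<close>, \<open>a\<close> and
  \<open>D\<close> are adjusted. The congruence for the colours makes \<open>f\<close> equal to
  \<open>g\<close> once \<open>D\<close> vanishes on all vertices.\<close>

lemma (in pair_graph) recolour_by_displacement:
  assumes q: "0 < q" "2 * q < p" and f: "colouring p q G f" and g: "colouring p q G g"
    and "potential p G f a"
    and "\<forall>(v, w) \<in> parcs G. turn p g v w = turn p f v w + D w - D v"
    and "\<forall>v \<in> pverts G. int (g v) = (int (f v) + D v) mod int p"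
  shows "(recolouring_step p q G)\<^sup>*\<^sup>* f g"
  using f assms(5-7)
proof (induction "\<Sum>v \<in> pverts G. nat \<bar>D v\<bar>" arbitrary: f a D rule: less_induct)
  case less
  note f = less.prems(1) and pot = less.prems(2) and D = less.prems(3) and gD = less.prems(4)
  have fp: "f v < p" if "v \<in> pverts G" for v
    using f that by (auto simp: colouring_def dest: PiE_mem)
  show ?case
  proof (cases "\<forall>v \<in> pverts G. D v = 0")
    case True
    have "f = g"
    proof (rule PiE_ext)
      show "f \<in> pverts G \<rightarrow>\<^sub>E {0..<p}" "g \<in> pverts G \<rightarrow>\<^sub>E {0..<p}"
        using f g by (auto simp: colouring_def)
      show "f v = g v" if "v \<in> pverts G" for v
      proof -
        have "int (g v) = int (f v) mod int p" using gD True that by simp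
        then show ?thesis using fp[OF that] by (simp flip: zmod_int)
      qed
    qed
    then show ?thesis by simp
  next
    case False
    then obtain u where u: "u \<in> pverts G" "D u \<noteq> 0" by blast
    define \<sigma> where "\<sigma> = sgn (D u)"
    have \<sigma>: "\<sigma> = 1 \<or> \<sigma> = -1" using u(2) by (auto simp: \<sigma>_def sgn_if)
    define S where "S = {v \<in> pverts G. 0 < \<sigma> * D v}"
    have "finite S" "u \<in> S" using pair_finite_verts u by (auto simp: S_def \<sigma>_def sgn_if)
    \<comment> \<open>A neighbour blocking the move of \<open>v\<close> would have smaller \<open>\<sigma> * a\<close> and have to move the same way.\<close>
    then obtain v where v: "is_arg_min (\<lambda>v. \<sigma> * a v) (\<lambda>v. v \<in> S) v"
      using ex_is_arg_min_if_finite[of S "\<lambda>v. \<sigma> * a v"] by auto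
    have vV: "v \<in> pverts G" and Dv: "0 < \<sigma> * D v" using v by (auto simp: is_arg_min_def S_def)
    have outside: "\<sigma> * D w \<le> 0" if "w \<in> pverts G" "\<sigma> * a w < \<sigma> * a v" for w
    proof -
      have "w \<notin> S" using v that(2) unfolding is_arg_min_def by blast
      then show ?thesis using that(1) unfolding S_def by (metis (mono_tags, lifting) mem_Collect_eq not_less)
    qed
    have room: "int q \<le> turn p f w v + \<sigma>" "turn p f w v + \<sigma> \<le> int p - int q" if e: "(w, v) \<in> parcs G" for w
    proof -
      have c: "int q \<le> turn p f w v" "turn p f w v \<le> int p - int q"
        using colouring_turn[OF q(1) f e] by auto
      have cg: "int q \<le> turn p f w v + D v - D w" "turn p f w v + D v - D w \<le> int p - int q"
        using colouring_turn[OF q(1) g e] D e by fastforce+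
      have av: "a v - a w = 2 * turn p f w v - int p" using pot e by (auto simp: potential_def)
      note o = outside[OF in_arcsD1[OF e]]
      \<comment> \<open>A turn \<open>p - q\<close> would give
        \<open>a v - a w = p - 2 * q > 0\<close>, hence \<open>D w \<le> 0 < D v\<close> by the
        choice of \<open>v\<close>, and the turn in \<open>g\<close> would exceed
        \<open>p - q\<close>. The case \<open>\<sigma> = -1\<close> is the mirror image.\<close>
      have "turn p f w v \<noteq> int p - int q" if "\<sigma> = 1"
        using that o cg(2) av Dv q(2) by auto
      moreover have "turn p f w v \<noteq> int q" if "\<sigma> = -1"
        using that o cg(1) av Dv q(2) by auto
      ultimately show "int q \<le> turn p f w v + \<sigma>" "turn p f w v + \<sigma> \<le> int p - int q"
        using c \<sigma> q by auto
    qed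
    define f' where "f' = f(v := nat ((int (f v) + \<sigma>) mod int p))"
    define \<delta> where "\<delta> = (\<lambda>_. 0 :: int)(v := \<sigma>)"
    have f'v: "int (f' v) = (int (f v) + \<sigma>) mod int p" using q by (simp add: f'_def)
    have to_v: "turn p f' w v = turn p f w v + \<sigma>" if e: "(w, v) \<in> parcs G" for w
    proof -
      have "w \<noteq> v" using no_loops'[OF e] .
      then have "turn p f' w v = ((int (f v) + \<sigma>) mod int p - int (f w)) mod int p"
        by (simp add: turn_def f'v) (simp add: f'_def)
      also have "\<dots> = (turn p f w v + \<sigma>) mod int p"
        by (simp add: turn_def mod_simps algebra_simps)
      also have "\<dots> = turn p f w v + \<sigma>"
        using room[OF e] q by (intro mod_pos_pos_trivial) auto
      finally show ?thesis .
    qed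
    have turn': "turn p f' x y = turn p f x y + \<delta> y - \<delta> x" if e: "(x, y) \<in> parcs G" for x y
    proof -
      have "x \<noteq> y" using no_loops'[OF e] .
      consider "y = v" | "x = v" | "x \<noteq> v" "y \<noteq> v" by blast
      then show ?thesis
      proof cases
        case 1
        then show ?thesis using to_v e \<open>x \<noteq> y\<close> by (simp add: \<delta>_def)
      next
        case 2
        have e': "(y, v) \<in> parcs G" using arcs_symmetric[OF e] 2 by simp
        have "turn p f' v y = int p - turn p f' y v"
          using room(1)[OF e'] to_v[OF e'] q by (intro turn_swap) linarith
        moreover have "turn p f v y = int p - turn p f y v"
          using colouring_turn(1)[OF q(1) f e'] q by (intro turn_swap) linarith
        ultimately show ?thesis using to_v[OF e'] 2 \<open>x \<noteq> y\<close> by (simp add: \<delta>_def)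
      next
        case 3
        then show ?thesis by (simp add: turn_def f'_def \<delta>_def)
      qed
    qed
    have f': "colouring p q G f'"
      unfolding colouring_iff_turn[OF q(1)]
    proof (intro conjI ballI)
      have "nat ((int (f v) + \<sigma>) mod int p) < p" using q by (simp add: nat_less_iff)
      then show "f' \<in> pverts G \<rightarrow>\<^sub>E {0..<p}"
        using f vV unfolding f'_def colouring_def by (auto simp: PiE_iff extensional_def)
    next
      fix e assume e: "e \<in> parcs G"
      obtain x y where xy: "e = (x, y)" by fastforce
      have exy: "(x, y) \<in> parcs G" and eyx: "(y, x) \<in> parcs G"
        using e arcs_symmetric xy by auto
      have "int q \<le> turn p f' x y \<and> turn p f' x y \<le> int p - int q"
      proof (cases "x = v")
        case True
        have "turn p f' v y = int p - turn p f' y v"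
          using room(1) eyx to_v True q by (intro turn_swap) force
        then show ?thesis using room eyx to_v True by force
      next
        case False
        then show ?thesis
          using turn'[OF exy] colouring_turn[OF q(1) f exy] room exy to_v by (cases "y = v") (auto simp: \<delta>_def)
      qed
      then show "case e of (x, y) \<Rightarrow> int q \<le> turn p f' x y \<and> turn p f' x y \<le> int p - int q"
        by (simp add: xy)
    qed
    have "{w \<in> pverts G. f w \<noteq> f' w} \<subseteq> {v}" by (auto simp: f'_def)
    then have "card {w \<in> pverts G. f w \<noteq> f' w} \<le> card {v}" by (intro card_mono) auto
    then have "recolouring_step p q G f f'" using f f' by (simp add: recolouring_step_def)
    moreover have "(recolouring_step p q G)\<^sup>*\<^sup>* f' g"
    \<comment> \<open>The turns change by the increments of \<open>\<delta>\<close>, and a potential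
      doubles turns, whence \<open>2 * \<delta>\<close>.\<close>
    proof (rule less.hyps[of "\<lambda>v. D v - \<delta> v" f' "\<lambda>v. a v + 2 * \<delta> v"])
      have "(\<Sum>w \<in> pverts G - {v}. nat \<bar>D w - \<delta> w\<bar>) = (\<Sum>w \<in> pverts G - {v}. nat \<bar>D w\<bar>)"
        by (intro sum.cong) (auto simp: \<delta>_def)
      moreover have "nat \<bar>D v - \<delta> v\<bar> < nat \<bar>D v\<bar>" using \<sigma> Dv by (auto simp: \<delta>_def)
      ultimately show "(\<Sum>w \<in> pverts G. nat \<bar>D w - \<delta> w\<bar>) < (\<Sum>w \<in> pverts G. nat \<bar>D w\<bar>)"
        using pair_finite_verts vV by (simp add: sum.remove[of _ v])
      show "colouring p q G f'" by fact
      show "potential p G f' (\<lambda>v. a v + 2 * \<delta> v)"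
        using pot turn' by (fastforce simp: potential_def)
      show "\<forall>(x, y) \<in> parcs G. turn p g x y = turn p f' x y + (D y - \<delta> y) - (D x - \<delta> x)"
        using D turn' by fastforce
      show "\<forall>w \<in> pverts G. int (g w) = (int (f' w) + (D w - \<delta> w)) mod int p"
      proof
        fix w assume w: "w \<in> pverts G"
        have "int (g w) = (int (f w) + D w) mod int p" using gD w by blast
        moreover have "(int (f' v) + (D v - \<sigma>)) mod int p = (int (f v) + D v) mod int p"
          unfolding f'v by (simp add: mod_simps)
        ultimately show "int (g w) = (int (f' w) + (D w - \<delta> w)) mod int p"
          by (cases "w = v") (auto simp: \<delta>_def f'_def)
      qed
    qed
    ultimately show ?thesis by (rule converse_rtranclp_into_rtranclp)
  qed
qed

lemma (in pair_graph) potential_imp_reachable: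
  assumes q: "0 < q" "2 * q < p" and f: "colouring p q G f" and g: "colouring p q G g"
    and a: "potential p G f a" and b: "potential p G g b"
  shows "(recolouring_step p q G)\<^sup>*\<^sup>* f g"
proof -
  \<comment> \<open>\<open>b - a\<close> may be odd, but its increments along arcs are even, so
    rounding by \<open>div\<close> leaves the halved increments exact.\<close>
  define D where "D v = (b v - a v) div 2" for v
  \<comment> \<open>\<open>\<kappa>\<close> is constant on components and makes the displacement match the colours, not only the turns.\<close>
  define \<kappa> where "\<kappa> v = (int (g v) - int (f v) - D v) mod int p" for v
  have D: "turn p g v w = turn p f v w + D w - D v" if "(v, w) \<in> parcs G" for v w
  proof -
    have "b w - a w = (b v - a v) + 2 * (turn p g v w - turn p f v w)"
      using that a b by (fastforce simp: potential_def)
    then show ?thesis by (simp add: D_def)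
  qed
  have \<kappa>: "\<kappa> w = \<kappa> v" if "(v, w) \<in> parcs G" for v w
  proof -
    have "(int (g w) - int (g v)) mod int p = (int (f w) - int (f v) + D w - D v) mod int p"
      using D[OF that] unfolding turn_def by (metis add_diff_eq mod_add_left_eq mod_mod_trivial)
    then show ?thesis unfolding \<kappa>_def mod_eq_dvd_iff by (simp add: algebra_simps)
  qed
  show ?thesis
  proof (rule recolour_by_displacement[OF q f g a])
    show "\<forall>(v, w) \<in> parcs G. turn p g v w = turn p f v w + (D w + \<kappa> w) - (D v + \<kappa> v)"
      using D \<kappa> by fastforce
    show "\<forall>v \<in> pverts G. int (g v) = (int (f v) + (D v + \<kappa> v)) mod int p"
    proof
      fix v assume "v \<in> pverts G"
      then have "g v < p" using g by (auto simp: colouring_def dest: PiE_mem)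
      then have "int (g v) = (int (f v) + D v + (int (g v) - int (f v) - D v)) mod int p" by simp
      also have "\<dots> = (int (f v) + (D v + \<kappa> v)) mod int p"
        unfolding \<kappa>_def add.assoc[symmetric] by (rule mod_add_right_eq[symmetric])
      finally show "int (g v) = (int (f v) + (D v + \<kappa> v)) mod int p" .
    qed
  qed
qed

lemma (in pair_graph) mixing_iff_potential:
  assumes "0 < q" "2 * q < p" "p < 4 * q"
  shows "mixing p q G \<longleftrightarrow> (\<nexists>f. unliftable p q G f)"
  using mixing_imp_potential[OF assms] potential_imp_reachable[OF assms(1,2)]
  unfolding unliftable_def mixing_def by meson

section \<open>Pulling back along folds\<close>

text \<open>Colourings are extensional functions, so composing with \<open>h\<close> has to be
  followed by a restriction to the vertices.\<close>

lemma colouring_pullback: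
  assumes "pair_wf_digraph G" "colouring p q (graph_image h G) c"
  shows "colouring p q G (restrict (c \<circ> h) (pverts G))"
proof -
  interpret pair_wf_digraph G by fact
  show ?thesis
    using assms(2) by (fastforce simp: colouring_def graph_image_def PiE_iff dest: in_arcsD1 in_arcsD2)
qed

lemma potential_pullback_iff:
  assumes "pair_wf_digraph G"
  shows "potential p G (restrict (c \<circ> h) (pverts G)) (b \<circ> h) \<longleftrightarrow> potential p (graph_image h G) c b"
proof -
  interpret pair_wf_digraph G by fact
  show ?thesis
    by (fastforce simp: potential_def graph_image_def turn_def dest: in_arcsD1 in_arcsD2)
qed

text \<open>By the condition on fibres, any potential of the pulled-back colouring descends along
  \<open>h\<close> and would be a potential of \<open>c\<close>. The condition is immediate for
  injective \<open>h\<close>, and for an elementary fold it comes from the common neighbour.\<close>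

lemma unliftable_pullback:
  assumes "pair_wf_digraph G" "unliftable p q (graph_image h G) c"
    and fib: "\<And>a u v. potential p G (restrict (c \<circ> h) (pverts G)) a \<Longrightarrow>
      u \<in> pverts G \<Longrightarrow> v \<in> pverts G \<Longrightarrow> h u = h v \<Longrightarrow> a u = a v"
  shows "unliftable p q G (restrict (c \<circ> h) (pverts G))"
  unfolding unliftable_def
proof (intro conjI notI)
  interpret pair_wf_digraph G by fact
  show "colouring p q G (restrict (c \<circ> h) (pverts G))"
    using assms by (intro colouring_pullback) (auto simp: unliftable_def)
  assume "\<exists>a. potential p G (restrict (c \<circ> h) (pverts G)) a"
  then obtain a where a: "potential p G (restrict (c \<circ> h) (pverts G)) a" by blast
  define b where "b = a \<circ> inv_into (pverts G) h"
  have bh: "b (h v) = a v" if "v \<in> pverts G" for v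
  proof -
    have "inv_into (pverts G) h (h v) \<in> pverts G" "h (inv_into (pverts G) h (h v)) = h v"
      using that by (auto intro: inv_into_into f_inv_into_f)
    then have "a (inv_into (pverts G) h (h v)) = a v" using that by (intro fib[OF a])
    then show ?thesis by (simp add: b_def)
  qed
  have "potential p G (restrict (c \<circ> h) (pverts G)) (b \<circ> h)"
    unfolding potential_def
  proof clarify
    fix v w assume e: "(v, w) \<in> parcs G"
    show "(b \<circ> h) w - (b \<circ> h) v = 2 * turn p (restrict (c \<circ> h) (pverts G)) v w - int p"
      using a e bh[OF in_arcsD1[OF e]] bh[OF in_arcsD2[OF e]] by (auto simp: potential_def)
  qed
  then show False
    using assms(2) unfolding potential_pullback_iff[OF assms(1)] unliftable_def by blast
qed

lemma elementary_fold_unliftable: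
  assumes "0 < q" "pair_graph G" "elementary_fold h G K" "unliftable p q K c"
  shows "\<exists>c. unliftable p q G c"
proof -
  interpret pair_graph G by fact
  obtain x y where xy: "x \<in> pverts G" "y \<in> pverts G" "graph_distance G x y = 2"
    and h: "h = id(y := x)" and K: "K = graph_image h G"
    using assms(3) by (auto simp: elementary_fold_def)
  obtain z where z: "(x, z) \<in> parcs G" "(z, y) \<in> parcs G"
    using xy(3) graph_distance_2_iff[OF assms(2)] by blast
  let ?c = "restrict (c \<circ> h) (pverts G)"
  have axy: "a x = a y" if "potential p G ?c a" for a
  proof -
    have "(z, x) \<in> parcs G" using z arcs_symmetric by blast
    then have "a x - a z = 2 * turn p ?c z x - int p" "a y - a z = 2 * turn p ?c z y - int p"
      using that z by (auto simp: potential_def)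
    moreover have "?c x = ?c y" using xy h by simp
    ultimately show ?thesis by (simp add: turn_def)
  qed
  have "unliftable p q G ?c"
  proof (rule unliftable_pullback)
    show "a u = a v" if "potential p G ?c a" "h u = h v" for a u v
      using axy[OF that(1)] that(2) by (cases "u = y"; cases "v = y") (auto simp: h)
  qed (use assms(4) K pair_wf_digraph in auto)
  then show ?thesis by blast
qed

lemma fold_composition_unliftable:
  assumes "fold_composition h G K" "0 < q" "pair_graph G"
  shows "pair_graph K \<and> ((\<exists>c. unliftable p q K c) \<longrightarrow> (\<exists>c. unliftable p q G c))"
  using assms
proof (induction rule: fold_composition.induct)
  case (fold_step f G K g L)
  then show ?case using elementary_fold_pair_graph elementary_fold_unliftable by blast
qed simp

text \<open>Library isomorphisms carry a separate map on arcs. As both digraphs have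
  \<open>fst\<close> and \<open>snd\<close> as tail and head, this map is determined by the one on
  vertices.\<close>

lemma digraph_iso_image:
  assumes "digraph_iso (with_proj G) (with_proj H)"
  obtains h where "inj_on h (pverts G)" "H = graph_image h G"
proof -
  obtain i where i: "pre_digraph.digraph_isomorphism (with_proj G) i"
    and H: "with_proj H = app_iso i (with_proj G)"
    using assms by (auto simp: digraph_iso_def)
  have ht: "fst = iso_tail i" "snd = iso_head i" "pverts H = iso_verts i ` pverts G"
    "parcs H = iso_arcs i ` parcs G"
    using arg_cong[OF H, of tail] arg_cong[OF H, of head] arg_cong[OF H, of verts]
      arg_cong[OF H, of arcs] by simp_all
  have "iso_arcs i e = map_prod (iso_verts i) (iso_verts i) e" if "e \<in> parcs G" for e
    using i that by (cases e) (auto simp: pre_digraph.digraph_isomorphism_def ht[symmetric] prod_eq_iff)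
  then have "H = graph_image (iso_verts i) G"
    using ht by (simp add: graph_image_def)
  then show ?thesis
    using that i by (auto simp: pre_digraph.digraph_isomorphism_def)
qed

lemma folds_to_unliftable:
  assumes "folds_to G H" "0 < q" "pair_graph G" "unliftable p q H c"
  shows "\<exists>c. unliftable p q G c"
proof -
  obtain f K where fK: "fold_composition f G K"
    and iso: "digraph_iso (with_proj (graph_image f G)) (with_proj H)"
    using assms(1) by (auto simp: folds_to_def)
  have K: "K = graph_image f G" using fold_composition_image[OF fK] .
  interpret K: pair_graph K using fold_composition_unliftable[OF fK assms(2,3)] by blast
  obtain h where h: "inj_on h (pverts K)" "H = graph_image h K"
    using digraph_iso_image[OF iso] K by metis
  have "unliftable p q K (restrict (c \<circ> h) (pverts K))"
    using h assms(4) by (intro unliftable_pullback) (auto dest: inj_onD)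
  then show ?thesis using fold_composition_unliftable[OF fK assms(2,3)] by blast
qed

section \<open>Relabelling graphs and folds along injective maps\<close>

lemma pverts_graph_image [simp]: "pverts (graph_image h G) = h ` pverts G"
  and parcs_graph_image [simp]: "parcs (graph_image h G) = map_prod h h ` parcs G"
  by (simp_all add: graph_image_def)

lemma graph_image_cong:
  assumes "pair_wf_digraph G" "\<And>v. v \<in> pverts G \<Longrightarrow> h v = k v"
  shows "graph_image h G = graph_image k G"
proof -
  interpret pair_wf_digraph G by fact
  have "h ` pverts G = k ` pverts G" using assms(2) by (intro image_cong) auto
  moreover have "map_prod h h ` parcs G = map_prod k k ` parcs G"
    using assms(2) arc_fst_in_verts arc_snd_in_verts
    by (intro image_cong refl) (simp add: map_prod_def case_prod_beta)
  ultimately show ?thesis by (simp add: graph_image_def)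
qed

lemma (in pair_graph) pair_graph_image:
  assumes "inj_on h (pverts G)"
  shows "pair_graph (graph_image h G)"
proof
  fix e assume "e \<in> parcs (graph_image h G)"
  then obtain u v where uv: "(u, v) \<in> parcs G" "e = (h u, h v)" by auto
  have V: "u \<in> pverts G" "v \<in> pverts G" using in_arcsD1[OF uv(1)] in_arcsD2[OF uv(1)] by auto
  show "fst e \<in> pverts (graph_image h G)" "snd e \<in> pverts (graph_image h G)"
    using uv V by auto
  show "fst e \<noteq> snd e"
    using uv V no_loops'[OF uv(1)] inj_onD[OF assms, of u v] by auto
next
  show "finite (pverts (graph_image h G))" "finite (parcs (graph_image h G))"
    using pair_finite_verts pair_finite_arcs by auto
  show "symmetric (with_proj (graph_image h G))"
    using arcs_symmetric by (force simp: symmetric_def intro!: symI)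
qed

lemma digraph_iso_graph_image:
  assumes "pair_wf_digraph G" "inj_on e (pverts G)"
  shows "digraph_iso (with_proj (graph_image e G)) (with_proj G)"
proof -
  interpret pair_wf_digraph G by fact
  let ?i = "\<lparr> iso_verts = e, iso_arcs = map_prod e e, iso_head = snd, iso_tail = fst \<rparr>"
  have "inj_on (map_prod e e) (pverts G \<times> pverts G)"
    using assms(2) by (intro map_prod_inj_on)
  moreover have "parcs G \<subseteq> pverts G \<times> pverts G" by (auto dest: in_arcsD1 in_arcsD2)
  ultimately have "inj_on (map_prod e e) (parcs G)" by (rule inj_on_subset)
  then have "digraph_isomorphism ?i"
    using assms(2) wf_digraph_axioms by (simp add: digraph_isomorphism_def)
  moreover have "with_proj (graph_image e G) = app_iso ?i (with_proj G)"
    by (simp add: app_iso_def with_proj_def)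
  ultimately have "digraph_iso (with_proj G) (with_proj (graph_image e G))"
    by (auto simp: digraph_iso_def)
  then show ?thesis by (rule digraph_iso_swap[OF wf_digraph_axioms])
qed

lemma fold_composition_trans:
  assumes "fold_composition g K L" "fold_composition f G K"
  shows "fold_composition (g \<circ> f) G L"
  using assms
proof (induction rule: fold_composition.induct)
  case (fold_step g K L h M)
  then show ?case using fold_composition.fold_step[of "g \<circ> f" G L h M] by (metis comp_assoc)
qed simp

lemma elementary_fold_composition:
  "elementary_fold f G K \<Longrightarrow> fold_composition f G K"
  using fold_step[OF fold_id] by fastforce

text \<open>An injective relabelling preserves and reflects arcs, hence distance 2 in the form of
  \<open>graph_distance_2_iff\<close>. This serves to carry folds of standard cycles over to their
  copies in another vertex type.\<close>

lemma (in pair_graph) elementary_fold_image: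
  assumes "inj_on e (pverts G)" "elementary_fold f G K"
  shows "\<exists>f'. elementary_fold f' (graph_image e G) (graph_image e K)"
proof -
  obtain x y where xy: "x \<in> pverts G" "y \<in> pverts G" "graph_distance G x y = 2"
    and f: "f = id(y := x)" and K: "K = graph_image f G"
    using assms(2) by (auto simp: elementary_fold_def)
  let ?f = "id(e y := e x)"
  have arc: "(e u, e v) \<in> parcs (graph_image e G) \<longleftrightarrow> (u, v) \<in> parcs G"
    if "u \<in> pverts G" "v \<in> pverts G" for u v
  proof
    assume "(e u, e v) \<in> parcs (graph_image e G)"
    then obtain x y where "(x, y) \<in> parcs G" "e u = e x" "e v = e y" by auto
    moreover from this have "x \<in> pverts G" "y \<in> pverts G" using in_arcsD1 in_arcsD2 by blast+
    ultimately show "(u, v) \<in> parcs G" using that assms(1) by (simp add: inj_on_eq_iff)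
  qed auto
  obtain z where z: "x \<noteq> y" "(x, y) \<notin> parcs G" "(x, z) \<in> parcs G" "(z, y) \<in> parcs G"
    using xy(3) graph_distance_2_iff[OF pair_graph] by blast
  have "e x \<noteq> e y" "(e x, e y) \<notin> parcs (graph_image e G)"
    "(e x, e z) \<in> parcs (graph_image e G)" "(e z, e y) \<in> parcs (graph_image e G)"
    using xy z in_arcsD1[OF z(4)] arc assms(1) by (auto simp: inj_on_eq_iff)
  then have "graph_distance (graph_image e G) (e x) (e y) = 2"
    using graph_distance_2_iff[OF pair_graph_image[OF assms(1)]] by blast
  moreover have "graph_image e K = graph_image ?f (graph_image e G)"
    unfolding K graph_image_comp
  proof (rule graph_image_cong[OF pair_wf_digraph])
    show "(e \<circ> f) v = (?f \<circ> e) v" if "v \<in> pverts G" for v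
      using that xy assms(1) by (auto simp: f inj_on_eq_iff)
  qed
  ultimately have "elementary_fold ?f (graph_image e G) (graph_image e K)"
    using xy by (auto simp: elementary_fold_def)
  then show ?thesis by blast
qed

text \<open>Since a merged vertex keeps one of the two old names, a relabelling that is injective on
  \<open>G\<close> stays injective on every graph obtained from it by folds.\<close>

lemma fold_composition_pverts: "fold_composition f G K \<Longrightarrow> pverts K \<subseteq> pverts G"
proof (induction rule: fold_composition.induct)
  case (fold_step f G K g L)
  then show ?case by (auto simp: elementary_fold_def split: if_splits)
qed simp

lemma fold_composition_graph_image:
  assumes "fold_composition f G K" "pair_graph G" "inj_on e (pverts G)"
  shows "\<exists>f'. fold_composition f' (graph_image e G) (graph_image e K)"
  using assms
proof (induction rule: fold_composition.induct)
  case (fold_id G)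
  then show ?case using fold_composition.fold_id by blast
next
  case (fold_step f G K g L)
  then obtain f' where f': "fold_composition f' (graph_image e G) (graph_image e K)" by blast
  \<comment> \<open>Only the first conjunct of \<open>fold_composition_unliftable\<close> is wanted;
    it does not mention \<open>q\<close>, which is set to 1.\<close>
  have "pair_graph K"
    using fold_composition_unliftable[OF fold_step.hyps(1) zero_less_one fold_step.prems(1)] by blast
  moreover have "inj_on e (pverts K)"
    using fold_step.prems(2) fold_composition_pverts[OF fold_step.hyps(1)] by (rule inj_on_subset)
  ultimately obtain g' where "elementary_fold g' (graph_image e K) (graph_image e L)"
    using pair_graph.elementary_fold_image fold_step.hyps(2) by blast
  then show ?case using fold_composition.fold_step[OF f'] by blast
qed

section \<open>Folding cycles\<close>

lemma pverts_cycle_graph [simp]: "pverts (cycle_graph n) = {0..<n}"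
  by (simp add: cycle_graph_def)

lemma cycle_graph_arc_iff:
  "(i, j) \<in> parcs (cycle_graph n) \<longleftrightarrow> i < n \<and> j < n \<and> (j = (i + 1) mod n \<or> i = (j + 1) mod n)"
  by (simp add: cycle_graph_def)

lemma parcs_cycle_graph:
  "parcs (cycle_graph n) = (\<Union>i<n. {(i, (i + 1) mod n), ((i + 1) mod n, i)})"
  by (auto simp: cycle_graph_def)

lemma Suc_mod_eq: "i < n \<Longrightarrow> Suc i mod n = (if Suc i = n then 0 else Suc i)"
  by auto

lemma pair_graph_cycle_graph:
  assumes "3 \<le> n"
  shows "pair_graph (cycle_graph n)"
proof
  show "fst e \<in> pverts (cycle_graph n)" "snd e \<in> pverts (cycle_graph n)" "fst e \<noteq> snd e"
    if "e \<in> parcs (cycle_graph n)" for e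
    using that assms by (cases e; auto simp: cycle_graph_arc_iff Suc_mod_eq split: if_splits)+
  show "finite (pverts (cycle_graph n))" by simp
  show "finite (parcs (cycle_graph n))" by (simp add: parcs_cycle_graph)
  show "symmetric (with_proj (cycle_graph n))"
    by (auto simp: symmetric_def cycle_graph_arc_iff intro!: symI)
qed

text \<open>The vertices \<open>n\<close> and \<open>n + 1\<close> wrap onto 0 and 1, and the
  closing edge between \<open>n + 1\<close> and 0 falls onto the edge between 1 and 0.\<close>

lemma graph_image_mod_cycle_graph:
  assumes "3 \<le> n"
  shows "graph_image (\<lambda>i. i mod n) (cycle_graph (n + 2)) = cycle_graph n"
proof -
  have "(\<lambda>i. i mod n) ` {0..<n + 2} = {0..<n}"
  proof
    show "{0..<n} \<subseteq> (\<lambda>i. i mod n) ` {0..<n + 2}" 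
    proof
      fix i assume "i \<in> {0..<n}"
      then show "i \<in> (\<lambda>i. i mod n) ` {0..<n + 2}" by (intro image_eqI[of _ _ i]) auto
    qed
  qed (use assms in auto)
  moreover have "map_prod (\<lambda>i. i mod n) (\<lambda>i. i mod n) ` parcs (cycle_graph (n + 2)) = parcs (cycle_graph n)"
  proof
    show "map_prod (\<lambda>i. i mod n) (\<lambda>i. i mod n) ` parcs (cycle_graph (n + 2)) \<subseteq> parcs (cycle_graph n)"
    proof
      fix e assume "e \<in> map_prod (\<lambda>i. i mod n) (\<lambda>i. i mod n) ` parcs (cycle_graph (n + 2))"
      then obtain i j where ij: "(i, j) \<in> parcs (cycle_graph (n + 2))" "e = (i mod n, j mod n)" by auto
      have "(i mod n, (i + 1) mod (n + 2) mod n) \<in> parcs (cycle_graph n)" if "i < n + 2" for i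
      proof (cases "i = n + 1")
        case True
        moreover have "(n + 1) mod n = 1" using mod_add_self1[of n 1] assms by simp
        ultimately show ?thesis using assms by (simp add: cycle_graph_arc_iff)
      next
        case False
        then show ?thesis using that assms by (simp add: cycle_graph_arc_iff mod_Suc_eq)
      qed
      moreover have "(i, j) \<in> parcs (cycle_graph n) \<longleftrightarrow> (j, i) \<in> parcs (cycle_graph n)" for i j
        by (auto simp: cycle_graph_arc_iff)
      ultimately show "e \<in> parcs (cycle_graph n)"
        using ij by (metis cycle_graph_arc_iff)
    qed
    have "(i, (i + 1) mod n) \<in> map_prod (\<lambda>i. i mod n) (\<lambda>i. i mod n) ` parcs (cycle_graph (n + 2)) \<and>
      ((i + 1) mod n, i) \<in> map_prod (\<lambda>i. i mod n) (\<lambda>i. i mod n) ` parcs (cycle_graph (n + 2))"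
      if "i < n" for i
    proof -
      have "(i, i + 1) \<in> parcs (cycle_graph (n + 2))" "(i + 1, i) \<in> parcs (cycle_graph (n + 2))"
        using that by (simp_all add: cycle_graph_arc_iff)
      then show ?thesis using that by force
    qed
    then show "parcs (cycle_graph n) \<subseteq> map_prod (\<lambda>i. i mod n) (\<lambda>i. i mod n) ` parcs (cycle_graph (n + 2))"
      unfolding parcs_cycle_graph[of n] by blast
  qed
  ultimately show ?thesis by (simp add: graph_image_def)
qed

text \<open>The vertices 0 and \<open>n\<close> have the common neighbour \<open>n + 1\<close>.
  Merging them leaves \<open>n + 1\<close> pendant at 0, where it is folded onto 1, another
  neighbour of 0. Together the two folds reduce modulo \<open>n\<close>.\<close>

lemma cycle_graph_fold_2:
  assumes "3 \<le> n"
  shows "\<exists>f. fold_composition f (cycle_graph (n + 2)) (cycle_graph n)"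
proof -
  let ?C = "cycle_graph (n + 2)"
  let ?f = "id(n := 0)" and ?g = "id(n + 1 := 1)"
  let ?K = "graph_image ?f ?C"
  have C: "pair_graph ?C" using assms by (intro pair_graph_cycle_graph) simp
  have "(0, n + 1) \<in> parcs ?C" "(n + 1, n) \<in> parcs ?C" "(0, n) \<notin> parcs ?C"
    using assms by (auto simp: cycle_graph_arc_iff)
  then have "graph_distance ?C 0 n = 2"
    using graph_distance_2_iff[OF C] assms by auto
  moreover have "0 \<in> pverts ?C" "n \<in> pverts ?C" by auto
  ultimately have f: "elementary_fold ?f ?C ?K" unfolding elementary_fold_def by blast
  have K: "pair_graph ?K" using elementary_fold_pair_graph[OF C f] .
  have "(1, 0) \<in> parcs ?C" "(0, n + 1) \<in> parcs ?C" "(1, n + 1) \<notin> parcs ?C"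
    using assms by (auto simp: cycle_graph_arc_iff)
  then have "(1, 0) \<in> parcs ?K" "(0, n + 1) \<in> parcs ?K" "(1, n + 1) \<notin> parcs ?K"
    using assms by (force simp: image_iff split: if_splits)+
  moreover have "1 \<noteq> n + 1" using assms by simp
  ultimately have "graph_distance ?K 1 (n + 1) = 2"
    using graph_distance_2_iff[OF K, of 1 "n + 1"] by blast
  moreover have "1 \<in> pverts ?K" "n + 1 \<in> pverts ?K"
    using assms by (auto simp: image_iff intro: bexI[of _ 1] bexI[of _ "n + 1"])
  ultimately have g: "elementary_fold ?g ?K (graph_image ?g ?K)"
    unfolding elementary_fold_def by blast
  have "graph_image ?g ?K = graph_image (\<lambda>i. i mod n) ?C"
    unfolding graph_image_comp
  proof (rule graph_image_cong)
    show "pair_wf_digraph ?C" using C by (simp add: pair_graph_def pair_digraph_def pair_fin_digraph_def)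
    show "(?g \<circ> ?f) v = v mod n" if "v \<in> pverts ?C" for v
    proof -
      have "v < n + 2" using that by simp
      then consider "v < n" | "v = n" | "v = n + 1" by linarith
      moreover have "(n + 1) mod n = 1" using mod_add_self1[of n 1] assms by simp
      ultimately show ?thesis using assms by cases auto
    qed
  qed
  then have "graph_image ?g ?K = cycle_graph n" using graph_image_mod_cycle_graph[OF assms] by simp
  then show ?thesis using fold_step[OF elementary_fold_composition[OF f] g] by auto
qed

lemma cycle_graph_fold:
  assumes "3 \<le> n"
  shows "\<exists>f. fold_composition f (cycle_graph (n + 2 * k)) (cycle_graph n)"
proof (induction k)
  case 0
  show ?case using fold_id by auto
next
  case (Suc k)
  moreover obtain g where "fold_composition g (cycle_graph (n + 2 * k + 2)) (cycle_graph (n + 2 * k))"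
    using cycle_graph_fold_2[of "n + 2 * k"] assms by auto
  ultimately show ?case using fold_composition_trans by fastforce
qed

text \<open>The colours advance by \<open>q\<close> at each step and close up since
  \<open>(4 * q + 2) * q = p * (2 * q)\<close>. Each step lowers a potential by
  \<open>p - 2 * q = 1\<close>, so a full round would lower it by \<open>4 * q + 2\<close> instead
  of restoring it.\<close>

lemma cycle_graph_unliftable:
  assumes "0 < q"
  shows "\<exists>f. unliftable (2 * q + 1) q (cycle_graph (4 * q + 2)) f"
proof -
  let ?p = "2 * q + 1" and ?C = "cycle_graph (4 * q + 2)"
  interpret pair_graph ?C using assms by (intro pair_graph_cycle_graph) simp
  let ?f = "restrict (\<lambda>i. i * q mod ?p) {0..<4 * q + 2}"
  have up: "turn ?p ?f i ((i + 1) mod (4 * q + 2)) = int q" if i: "i < 4 * q + 2" for i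
  proof -
    have "int (?f i) = (int i * int q) mod int ?p" using i by (simp add: zmod_int)
    moreover have "int (?f ((i + 1) mod (4 * q + 2))) = (int (i + 1) * int q) mod int ?p"
    proof (cases "i + 1 = 4 * q + 2")
      case True
      have "int (i + 1) * int q = int ?p * (2 * int q)" unfolding True by (simp add: algebra_simps)
      then have "(int (i + 1) * int q) mod int ?p = 0" by (metis mod_mult_self1_is_0)
      moreover have "?f ((i + 1) mod (4 * q + 2)) = 0" using True by simp
      ultimately show ?thesis by (metis of_nat_0)
    next
      case False
      then have "i + 1 < 4 * q + 2" using i by simp
      then show ?thesis by (simp add: zmod_int algebra_simps)
    qed
    ultimately have "turn ?p ?f i ((i + 1) mod (4 * q + 2)) = int q mod int ?p"
      by (simp add: turn_def mod_simps algebra_simps)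
    then show ?thesis by simp
  qed
  have down: "turn ?p ?f ((i + 1) mod (4 * q + 2)) i = int q + 1" if "i < 4 * q + 2" for i
    using turn_swap[of ?p ?f i] up[OF that] assms by simp
  have "colouring ?p q ?C ?f"
    unfolding colouring_iff_turn[OF assms]
  proof (intro conjI)
    show "?f \<in> pverts ?C \<rightarrow>\<^sub>E {0..<?p}" by auto
    show "\<forall>(u, v) \<in> parcs ?C. int q \<le> turn ?p ?f u v \<and> turn ?p ?f u v \<le> int ?p - int q"
      unfolding parcs_cycle_graph using up down by auto
  qed
  moreover have False if a: "potential ?p ?C ?f a" for a
  proof -
    have st: "a ((i + 1) mod (4 * q + 2)) = a i - 1" if "i < 4 * q + 2" for i
    proof -
      have "(i, (i + 1) mod (4 * q + 2)) \<in> parcs ?C" using that unfolding parcs_cycle_graph by blast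
      then show ?thesis using a up[OF that] unfolding potential_def by fastforce
    qed
    have "a i = a 0 - int i" if "i < 4 * q + 2" for i
      using that
    proof (induction i)
      case (Suc i)
      then show ?case using st[of i] by simp
    qed simp
    from this[of "4 * q + 1"] have "a (4 * q + 1) = a 0 - int (4 * q + 1)" by simp
    then show False using st[of "4 * q + 1"] by simp
  qed
  ultimately show ?thesis by (auto simp: unliftable_def)
qed

section \<open>Folding bipartite graphs onto cycles\<close>

text \<open>Connectedness is used in the form that every such \<open>S\<close> is the whole vertex
  set. This passes to images by taking preimages, so it survives folds without any handling of
  walks.\<close>

definition neighbour_closed :: "'a pair_pre_digraph \<Rightarrow> 'a set \<Rightarrow> bool" where
  "neighbour_closed G S \<longleftrightarrow> S \<subseteq> pverts G \<and> S \<noteq> {} \<and> (\<forall>(v, w) \<in> parcs G. v \<in> S \<longrightarrow> w \<in> S)"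

lemma (in pair_graph) connected_neighbour_closed:
  assumes "connected (with_proj G)" "neighbour_closed G S"
  shows "S = pverts G"
proof
  show "S \<subseteq> pverts G" using assms(2) by (simp add: neighbour_closed_def)
  obtain u where u: "u \<in> S" "u \<in> pverts G" using assms(2) by (auto simp: neighbour_closed_def)
  show "pverts G \<subseteq> S"
  proof
    fix v assume "v \<in> pverts G"
    then have "u \<rightarrow>\<^sup>*\<^bsub>mk_symmetric (with_proj G)\<^esub> v"
      using assms(1) u by (auto simp: connected_def strongly_connected_def)
    then have "u \<rightarrow>\<^sup>*\<^bsub>with_proj G\<^esub> v" using reachable_mk_symmetric_eq[OF sym_arcs] by blast
    then show "v \<in> S"
    proof (induction rule: reachable_induct)
      case base
      show ?case by fact
    next
      case (step x y)
      then show ?case using assms(2) by (auto simp: neighbour_closed_def)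
    qed
  qed
qed

lemma neighbour_closed_graph_image:
  assumes "\<And>S. neighbour_closed G S \<Longrightarrow> S = pverts G" "pair_wf_digraph G"
    and "neighbour_closed (graph_image h G) T"
  shows "T = h ` pverts G"
proof -
  interpret pair_wf_digraph G by fact
  let ?S = "{v \<in> pverts G. h v \<in> T}"
  have "neighbour_closed G ?S"
    using assms(3) unfolding neighbour_closed_def by (fastforce dest: in_arcsD2)
  then have "?S = pverts G" by (rule assms(1))
  then show ?thesis using assms(3) by (auto simp: neighbour_closed_def)
qed

lemma bipartiteE:
  assumes "bipartite G"
  obtains A B where "A \<union> B = pverts G" "A \<inter> B = {}"
    "\<And>u v. (u, v) \<in> parcs G \<Longrightarrow> (u \<in> A \<and> v \<in> B) \<or> (u \<in> B \<and> v \<in> A)"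
proof -
  obtain A B where AB: "A \<union> B = pverts G" "A \<inter> B = {}"
    and arcs: "\<forall>(u, v) \<in> parcs G. (u \<in> A \<and> v \<in> B) \<or> (u \<in> B \<and> v \<in> A)"
    using assms unfolding bipartite_def by (elim exE conjE) (rule that)
  show ?thesis
  proof (rule that[OF AB])
    show "(u \<in> A \<and> v \<in> B) \<or> (u \<in> B \<and> v \<in> A)" if "(u, v) \<in> parcs G" for u v
      using bspec[OF arcs that] by simp
  qed
qed

text \<open>The two merged vertices have a common neighbour and hence lie on the same side.\<close>

lemma elementary_fold_bipartite:
  assumes "pair_graph G" "bipartite G" "elementary_fold h G K"
  shows "bipartite K"
proof -
  interpret pair_graph G by fact
  obtain x y where xy: "x \<in> pverts G" "y \<in> pverts G" "graph_distance G x y = 2"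
    and h: "h = id(y := x)" and K: "K = graph_image h G"
    using assms(3) by (auto simp: elementary_fold_def)
  obtain z where z: "(x, z) \<in> parcs G" "(z, y) \<in> parcs G"
    using xy(3) graph_distance_2_iff[OF assms(1)] by blast
  obtain A B where AB: "A \<union> B = pverts G" "A \<inter> B = {}"
    and arcs: "\<And>u v. (u, v) \<in> parcs G \<Longrightarrow> (u \<in> A \<and> v \<in> B) \<or> (u \<in> B \<and> v \<in> A)"
    using bipartiteE[OF assms(2)] by metis
  have "x \<in> A \<longleftrightarrow> y \<in> A" using arcs[OF z(1)] arcs[OF z(2)] AB(2) by blast
  then have "h ` A \<inter> h ` B = {}" using AB xy by (auto simp: h split: if_splits)
  moreover have "h ` A \<union> h ` B = pverts K" using AB(1) by (simp add: K image_Un[symmetric])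
  moreover have "\<forall>(u, v) \<in> parcs K. (u \<in> h ` A \<and> v \<in> h ` B) \<or> (u \<in> h ` B \<and> v \<in> h ` A)"
    using arcs by (force simp: K)
  ultimately show ?thesis unfolding bipartite_def by blast
qed

text \<open>The converse direction to \<open>unliftable_pullback\<close>: as \<open>x\<close> and
  \<open>y\<close> have the same colour, \<open>f\<close> is the pullback of its restriction, and a
  potential of the restriction would pull back to one of \<open>f\<close>.\<close>

lemma elementary_fold_push_unliftable:
  assumes "pair_graph G" "unliftable p q G f"
    and "x \<in> pverts G" "y \<in> pverts G" "x \<noteq> y" "f x = f y"
  shows "unliftable p q (graph_image (id(y := x)) G) (restrict f (pverts G - {y}))"
proof -
  interpret pair_graph G by fact
  let ?h = "id(y := x)" and ?f = "restrict f (pverts G - {y})"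
  have col: "colouring p q G f" using assms(2) by (simp add: unliftable_def)
  have fh: "?f (?h v) = f v" if "v \<in> pverts G" for v
    using that assms(3-6) by auto
  have "restrict (?f \<circ> ?h) (pverts G) = f"
  proof
    show "restrict (?f \<circ> ?h) (pverts G) v = f v" for v
      using fh[of v] col PiE_arb[of f "pverts G" "\<lambda>_. {0..<p}" v] by (auto simp: colouring_def simp del: fun_upd_apply)
  qed
  moreover have "colouring p q (graph_image ?h G) ?f"
    unfolding colouring_def
  proof (intro conjI)
    have V: "pverts (graph_image ?h G) = pverts G - {y}" using assms(3-5) by auto
    show "?f \<in> pverts (graph_image ?h G) \<rightarrow>\<^sub>E {0..<p}"
      unfolding V using col by (auto simp: colouring_def dest: PiE_mem)
    show "\<forall>(u, v) \<in> parcs (graph_image ?h G). int q \<le> \<bar>int (?f u) - int (?f v)\<bar> \<and>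
      \<bar>int (?f u) - int (?f v)\<bar> \<le> int p - int q"
    proof clarify
      fix u v assume "(u, v) \<in> parcs (graph_image ?h G)"
      then obtain s t where st: "(s, t) \<in> parcs G" "u = ?h s" "v = ?h t" by auto
      then have "?f u = f s" "?f v = f t" using fh in_arcsD1 in_arcsD2 by blast+
      then show "int q \<le> \<bar>int (?f u) - int (?f v)\<bar> \<and> \<bar>int (?f u) - int (?f v)\<bar> \<le> int p - int q"
        using col st(1) by (auto simp: colouring_def)
    qed
  qed
  ultimately show ?thesis
    using assms(2) potential_pullback_iff[OF pair_wf_digraph, of p ?f ?h]
    unfolding unliftable_def by metis
qed

text \<open>
  By local injectivity every vertex has at most one neighbour reached by turn \<open>q\<close> and one by turn
  \<open>q + 1\<close>. If some vertex has none reached by turn \<open>q\<close>, the graph is a path and the distance to that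
  end is a potential.
\<close>

lemma (in pair_graph) locally_injective_imp_cycle:
  assumes q: "0 < q" "p = 2 * q + 1" and bip: "bipartite G"
    and conn: "\<And>S. neighbour_closed G S \<Longrightarrow> S = pverts G"
    and f: "unliftable p q G f"
    and inj: "\<And>x y z. (z, x) \<in> parcs G \<Longrightarrow> (z, y) \<in> parcs G \<Longrightarrow> f x = f y \<Longrightarrow> x = y"
  shows "\<exists>e m. 0 < m \<and> (4 * q + 2) dvd m \<and> inj_on e {0..<m} \<and> G = graph_image e (cycle_graph m)"
proof -
  have col: "colouring p q G f" using f by (simp add: unliftable_def)
  have fp: "f v < p" if "v \<in> pverts G" for v
    using col that by (auto simp: colouring_def dest: PiE_mem)
  \<comment> \<open>For \<open>p = 2 * q + 1\<close> every turn is \<open>q\<close> or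
    \<open>q + 1\<close>, and reversing an arc exchanges the two. So \<open>R\<close> orients every
    edge.\<close>
  define R where "R = {(v, w) \<in> parcs G. turn p f v w = int q}"
  have R_arc: "(v, w) \<in> parcs G" and R_turn: "turn p f v w = int q" if "(v, w) \<in> R" for v w
    using that by (auto simp: R_def)
  have R_or: "(v, w) \<in> R \<or> (w, v) \<in> R" if e: "(v, w) \<in> parcs G" for v w
  proof -
    have "turn p f v w = int q \<or> turn p f v w = int q + 1"
      using colouring_turn[OF q(1) col e] q(2) by auto
    moreover have "turn p f w v = int p - turn p f v w"
      using colouring_turn(1)[OF q(1) col e] q(1) by (intro turn_swap) linarith
    ultimately show ?thesis using e arcs_symmetric[OF e] q(2) by (auto simp: R_def)
  qed
  have R_swap: "turn p f w v = int q + 1" if "(v, w) \<in> R" for v w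
    using turn_swap[of p f v w] R_turn[OF that] q by simp
  have same: "w = w'"
    \<comment> \<open>Equal turns from \<open>v\<close> lead to equal colours, so local injectivity
      applies.\<close>
    if e: "(v, w) \<in> parcs G" "(v, w') \<in> parcs G" and t: "turn p f v w = turn p f v w'" for v w w'
  proof -
    have "int p dvd (int (f w) - int (f v)) - (int (f w') - int (f v))"
      using t unfolding turn_def by (simp only: mod_eq_dvd_iff)
    then have "int (f w) mod int p = int (f w') mod int p" by (simp add: mod_eq_dvd_iff)
    then have "f w = f w'" using fp in_arcsD2[OF e(1)] in_arcsD2[OF e(2)] by (simp flip: zmod_int)
    then show ?thesis using inj e by blast
  qed
  have R_right: "w = w'" if "(v, w) \<in> R" "(v, w') \<in> R" for v w w'
    using same that R_arc R_turn by metis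
  have R_left: "v = v'" if "(v, w) \<in> R" "(v', w) \<in> R" for v v' w
    using same[of w v v'] that R_arc R_swap arcs_symmetric by metis
  have total: "\<exists>w. (v, w) \<in> R" if "v \<in> pverts G" for v
  proof (rule ccontr)
    assume top: "\<nexists>w. (v, w) \<in> R"
    have "neighbour_closed G {u \<in> pverts G. \<exists>n. (u, v) \<in> R ^^ n}" (is "neighbour_closed G ?S")
      unfolding neighbour_closed_def
    proof (intro conjI ballI)
      have "v \<in> ?S" using that by (auto intro: exI[of _ 0])
      then show "?S \<noteq> {}" by blast
      fix e assume "e \<in> parcs G"
      then obtain u w where e: "e = (u, w)" "(u, w) \<in> parcs G" by (cases e) auto
      have "w \<in> ?S" if "u \<in> ?S"
      proof -
        obtain n where n: "(u, v) \<in> R ^^ n" using \<open>u \<in> ?S\<close> by blast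
        have "\<exists>n. (w, v) \<in> R ^^ n"
          using R_or[OF e(2)]
        proof
          assume uw: "(u, w) \<in> R"
          then have "u \<noteq> v" using top by blast
          then obtain k where "(u, v) \<in> R ^^ Suc k" using n by (cases n) auto
          from relpow_Suc_D2[OF this] obtain w' where "(u, w') \<in> R" "(w', v) \<in> R ^^ k" by blast
          then show ?thesis using R_right[OF uw] by blast
        next
          assume "(w, u) \<in> R"
          then have "(w, v) \<in> R ^^ Suc n" using n by (rule relpow_Suc_I2)
          then show ?thesis by blast
        qed
        then show ?thesis using in_arcsD2[OF e(2)] by simp
      qed
      then show "case e of (u, w) \<Rightarrow> u \<in> ?S \<longrightarrow> w \<in> ?S" using e(1) by simp
    qed blast
    then have "\<forall>u \<in> pverts G. \<exists>n. (u, v) \<in> R ^^ n" using conn by blast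
    then obtain a where a: "\<And>u. u \<in> pverts G \<Longrightarrow> (u, v) \<in> R ^^ a u" by metis
    \<comment> \<open>\<open>R\<close> is functional and cannot leave \<open>v\<close>, so the
      length of an \<open>R\<close>-walk to \<open>v\<close> is determined by its start.\<close>
    have unique: "n = m" if "(u, v) \<in> R ^^ n" "(u, v) \<in> R ^^ m" for u n m
      using that
    proof (induction n arbitrary: u m)
      case 0
      then have "u = v" by simp
      show ?case
      proof (cases m)
        case (Suc k)
        then have "(u, v) \<in> R ^^ Suc k" using "0.prems"(2) by simp
        from relpow_Suc_D2[OF this] show ?thesis using top \<open>u = v\<close> by blast
      qed simp
    next
      case (Suc n)
      from relpow_Suc_D2[OF Suc.prems(1)] obtain w where w: "(u, w) \<in> R" "(w, v) \<in> R ^^ n" by blast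
      then have "u \<noteq> v" using top by blast
      then obtain k where k: "m = Suc k" using Suc.prems(2) by (cases m) auto
      then have "(u, v) \<in> R ^^ Suc k" using Suc.prems(2) by simp
      from relpow_Suc_D2[OF this] obtain w' where w': "(u, w') \<in> R" "(w', v) \<in> R ^^ k" by blast
      then have "(w, v) \<in> R ^^ k" using R_right[OF w(1) w'(1)] by simp
      then show ?case using Suc.IH[OF w(2)] k by simp
    qed
    have a_step: "a u = Suc (a w)" if "(u, w) \<in> R" for u w
    proof (rule unique)
      show "(u, v) \<in> R ^^ a u" using a in_arcsD1[OF R_arc[OF that]] .
      show "(u, v) \<in> R ^^ Suc (a w)" using relpow_Suc_I2[OF that a[OF in_arcsD2[OF R_arc[OF that]]]] .
    qed
    \<comment> \<open>The turns \<open>q\<close> and \<open>q + 1\<close> ask for the increments -1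
      and 1, which is how the distance to \<open>v\<close> changes along and against
      \<open>R\<close>.\<close>
    have "potential p G f (\<lambda>v. int (a v))"
      unfolding potential_def
    proof clarify
      fix u w assume "(u, w) \<in> parcs G"
      then consider "(u, w) \<in> R" | "(w, u) \<in> R" using R_or by blast
      then show "int (a w) - int (a u) = 2 * turn p f u w - int p"
        using a_step R_turn R_swap q(2) by cases auto
    qed
    then show False using f by (auto simp: unliftable_def)
  qed
  then obtain s where s: "\<And>v. v \<in> pverts G \<Longrightarrow> (v, s v) \<in> R" by metis
  have "pverts G \<noteq> {}"
  proof
    assume "pverts G = {}"
    then have "parcs G = {}" using in_arcsD1 by fastforce
    then show False using f by (simp add: unliftable_def potential_def)
  qed
  then obtain v\<^sub>0 where v\<^sub>0: "v\<^sub>0 \<in> pverts G" by blast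
  \<comment> \<open>Following \<open>R\<close> from \<open>v\<^sub>0\<close> must repeat a vertex.
    As predecessors under \<open>R\<close> are unique too, a repetition can be shifted back to the
    start, so the walk is a cycle whose length is the first return time \<open>m\<close>.\<close>
  define e where "e i = (s ^^ i) v\<^sub>0" for i
  have eV: "e i \<in> pverts G" for i
    by (induction i) (use v\<^sub>0 s in_arcsD2[OF R_arc] in \<open>auto simp: e_def\<close>)
  have e_R: "(e i, e (Suc i)) \<in> R" for i using s[OF eV[of i]] by (simp add: e_def)
  have cancel: "e j = e 0" if "e (i + j) = e i" for i j
    using that
  proof (induction i)
    case (Suc i)
    then show ?case using R_left e_R by (metis add_Suc)
  qed simp
  have "\<not> inj e"
    using eV pair_finite_verts by (metis finite_subset image_subset_iff infinite_UNIV_nat finite_imageD)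
  then obtain i j where "i < j" "e j = e i" by (metis inj_onI linorder_neqE_nat)
  then have ex: "\<exists>m. 0 < m \<and> e m = e 0"
    using cancel[of i "j - i"] by (intro exI[of _ "j - i"]) simp
  define m where "m = (LEAST m. 0 < m \<and> e m = e 0)"
  have m: "0 < m" "e m = e 0" using LeastI_ex[OF ex] by (auto simp: m_def)
  have e_lt: "i = j" if "i \<le> j" "j < m" "e i = e j" for i j
  proof (rule ccontr)
    assume "i \<noteq> j"
    then have "0 < j - i \<and> e (j - i) = e 0" using that cancel[of i "j - i"] by simp
    then have "m \<le> j - i" unfolding m_def by (rule Least_le)
    then show False using that m(1) by simp
  qed
  have e_inj: "inj_on e {0..<m}"
    using e_lt by (intro inj_onI) (metis atLeastLessThan_iff nat_le_linear)
  have wrap: "e ((i + 1) mod m) = e (Suc i)" if "i < m" for i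
    using that m(2) by (cases "i + 1 = m") auto
  have nb: "\<exists>j < m. w = e j \<and> (i, j) \<in> parcs (cycle_graph m)" if "i < m" "(e i, w) \<in> parcs G" for i w
    using R_or[OF that(2)]
  proof
    assume "(e i, w) \<in> R"
    then have "w = e ((i + 1) mod m)" using R_right e_R wrap[OF that(1)] by metis
    then show ?thesis using that(1) m(1) by (intro exI[of _ "(i + 1) mod m"]) (simp add: cycle_graph_arc_iff)
  next
    assume wi: "(w, e i) \<in> R"
    define j where "j = (if i = 0 then m - 1 else i - 1)"
    have j: "j < m" "(j + 1) mod m = i" using that(1) m(1) by (auto simp: j_def)
    then have "(e j, e i) \<in> R" using e_R[of j] wrap[of j] by simp
    then have "w = e j" using wi R_left by blast
    then show ?thesis using j that(1) by (intro exI[of _ j]) (simp add: cycle_graph_arc_iff)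
  qed
  \<comment> \<open>All neighbours of the cycle lie on it, so by connectedness it is all of
    \<open>G\<close>.\<close>
  have "neighbour_closed G (e ` {0..<m})"
    unfolding neighbour_closed_def using eV m(1) nb by fastforce
  then have V: "pverts G = e ` {0..<m}" using conn by blast
  have "parcs G = map_prod e e ` parcs (cycle_graph m)"
  proof
    show "parcs G \<subseteq> map_prod e e ` parcs (cycle_graph m)"
    proof
      fix x assume x: "x \<in> parcs G"
      then have "fst x \<in> pverts G" by (rule arc_fst_in_verts)
      then obtain i where i: "i < m" "fst x = e i" using V by auto
      then obtain j where "snd x = e j" "(i, j) \<in> parcs (cycle_graph m)"
        using nb[of i "snd x"] x by (metis prod.collapse)
      then have "x = map_prod e e (i, j)" using i by (simp add: prod_eq_iff)
      then show "x \<in> map_prod e e ` parcs (cycle_graph m)" using \<open>(i, j) \<in> parcs (cycle_graph m)\<close> by (rule image_eqI)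
    qed
    have "(e i, e ((i + 1) mod m)) \<in> parcs G" if "i < m" for i
      using R_arc[OF e_R[of i]] wrap[OF that] by simp
    then show "map_prod e e ` parcs (cycle_graph m) \<subseteq> parcs G"
      unfolding parcs_cycle_graph using arcs_symmetric by auto
  qed
  then have G: "G = graph_image e (cycle_graph m)" using V by (simp add: graph_image_def)
  \<comment> \<open>Colours advance by \<open>q\<close> along the cycle, so after a full round
    \<open>p\<close> divides \<open>m * q\<close>, hence \<open>m\<close>.\<close>
  have "int (f (e i)) mod int p = (int (f v\<^sub>0) + int i * int q) mod int p" for i
  proof (induction i)
    case 0
    show ?case by (simp add: e_def)
  next
    case (Suc i)
    have "(int (f (e (Suc i))) - int (f (e i))) mod int p = int q mod int p"
      using R_turn[OF e_R[of i]] unfolding turn_def by (metis mod_mod_trivial)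
    then have "int p dvd int (f (e (Suc i))) - int (f (e i)) - int q" by (simp only: mod_eq_dvd_iff)
    moreover have "int p dvd int (f (e i)) - (int (f v\<^sub>0) + int i * int q)"
      using Suc by (simp only: mod_eq_dvd_iff)
    ultimately have "int p dvd (int (f (e (Suc i))) - int (f (e i)) - int q) +
      (int (f (e i)) - (int (f v\<^sub>0) + int i * int q))" by (rule dvd_add)
    then show ?case unfolding mod_eq_dvd_iff by (simp add: algebra_simps)
  qed
  from this[of m] have "int p dvd int m * int q"
    unfolding m(2) by (simp add: e_def mod_eq_dvd_iff)
  then have "p dvd m * q" by (simp flip: of_nat_mult)
  moreover have "coprime p q"
  proof (rule coprimeI)
    show "d dvd 1" if "d dvd p" "d dvd q" for d
      using that dvd_add_right_iff[of d "2 * q" 1] unfolding q(2) by simp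
  qed
  ultimately have "p dvd m" by (simp add: coprime_dvd_mult_left_iff)
  obtain A B where AB: "A \<inter> B = {}"
    and arcs: "\<And>u v. (u, v) \<in> parcs G \<Longrightarrow> (u \<in> A \<and> v \<in> B) \<or> (u \<in> B \<and> v \<in> A)"
    using bipartiteE[OF bip] by metis
  \<comment> \<open>The sides alternate along the cycle, so \<open>m\<close> is even. Since
    \<open>p\<close> is odd, \<open>2 * p = 4 * q + 2\<close> divides \<open>m\<close>; in
    particular \<open>m\<close> is at least 6 and \<open>cycle_graph m\<close> is a genuine
    cycle.\<close>
  have "e i \<in> A \<longleftrightarrow> (e 0 \<in> A \<longleftrightarrow> even i)" for i
  proof (induction i)
    case (Suc i)
    then show ?case using arcs[OF R_arc[OF e_R[of i]]] AB by auto
  qed simp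
  from this[of m] have "even m" using m(2) by auto
  then have "2 * p dvd m" using \<open>p dvd m\<close> q(2) by (intro divides_mult) auto
  then have "4 * q + 2 dvd m" using q(2) by (simp add: algebra_simps)
  then show ?thesis using m(1) e_inj G by blast
qed

text \<open>Induction on the number of vertices: equally coloured neighbours of a vertex are not
  adjacent, hence at distance 2, and folding them keeps all hypotheses. The result is a copy of the
  cycle under \<open>e\<close> because folds stay within the vertex type of
  \<open>G\<close>.\<close>

lemma unliftable_imp_fold_cycle:
  assumes "0 < q" "pair_graph G" "bipartite G" "\<And>S. neighbour_closed G S \<Longrightarrow> S = pverts G"
    and "unliftable (2 * q + 1) q G f"
  shows "\<exists>h e. fold_composition h G (graph_image e (cycle_graph (4 * q + 2))) \<and> inj_on e {0..<4 * q + 2}"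
  using assms(2-5)
proof (induction "card (pverts G)" arbitrary: G f rule: less_induct)
  case less
  interpret pair_graph G by fact
  show ?case
  proof (cases "\<exists>x y z. (z, x) \<in> parcs G \<and> (z, y) \<in> parcs G \<and> f x = f y \<and> x \<noteq> y")
    case True
    then obtain x y z where xyz: "(z, x) \<in> parcs G" "(z, y) \<in> parcs G" "f x = f y" "x \<noteq> y" by blast
    have V: "x \<in> pverts G" "y \<in> pverts G" using in_arcsD2 xyz by blast+
    let ?K = "graph_image (id(y := x)) G"
    have "(x, y) \<notin> parcs G"
      using less.prems(4) xyz(3) assms(1) by (auto simp: unliftable_def colouring_def)
    then have "graph_distance G x y = 2"
      using graph_distance_2_iff[OF less.prems(1)] xyz arcs_symmetric by blast
    then have fold: "elementary_fold (id(y := x)) G ?K"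
      using V unfolding elementary_fold_def by blast
    have "pverts ?K \<subseteq> pverts G - {y}" using V xyz(4) by auto
    then have "pverts ?K \<subset> pverts G" using V by blast
    then have less_card: "card (pverts ?K) < card (pverts G)"
      by (rule psubset_card_mono[OF pair_finite_verts])
    have "\<exists>h e. fold_composition h ?K (graph_image e (cycle_graph (4 * q + 2))) \<and> inj_on e {0..<4 * q + 2}"
    proof (rule less.hyps[OF less_card])
      show "pair_graph ?K" using elementary_fold_pair_graph[OF less.prems(1) fold] .
      show "bipartite ?K" using elementary_fold_bipartite[OF less.prems(1,2) fold] .
      show "S = pverts ?K" if "neighbour_closed ?K S" for S
        using neighbour_closed_graph_image[OF less.prems(3) pair_wf_digraph that] by simp
      show "unliftable (2 * q + 1) q ?K (restrict f (pverts G - {y}))"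
        using elementary_fold_push_unliftable[OF less.prems(1,4) V xyz(4,3)] .
    qed
    then obtain h e where "fold_composition h ?K (graph_image e (cycle_graph (4 * q + 2)))"
      and e: "inj_on e {0..<4 * q + 2}"
      by blast
    then show ?thesis
      using fold_composition_trans[OF _ elementary_fold_composition[OF fold]] by blast
  next
    case False
    then obtain e m where m: "0 < m" "(4 * q + 2) dvd m" "inj_on e {0..<m}" "G = graph_image e (cycle_graph m)"
      using locally_injective_imp_cycle[OF assms(1) refl less.prems(2,3,4)] by blast
    then obtain k where "m = (4 * q + 2) * Suc k" by (metis dvdE gr0_conv_Suc mult_0_right not_gr0)
    \<comment> \<open>The excess over \<open>4 * q + 2\<close> is even, so shortening the cycle by
      two at a time reaches that length.\<close>
    then have mk: "m = (4 * q + 2) + 2 * ((2 * q + 1) * k)" by (simp add: algebra_simps)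
    have "3 \<le> 4 * q + 2" using assms(1) by simp
    from cycle_graph_fold[OF this] obtain h
      where "fold_composition h (cycle_graph m) (cycle_graph (4 * q + 2))"
      unfolding mk by blast
    moreover have "pair_graph (cycle_graph m)" using assms(1) mk by (intro pair_graph_cycle_graph) simp
    ultimately obtain h' where "fold_composition h' G (graph_image e (cycle_graph (4 * q + 2)))"
      using fold_composition_graph_image m by (metis pverts_cycle_graph)
    moreover have "inj_on e {0..<4 * q + 2}" using m(3) mk by (rule_tac inj_on_subset) auto
    ultimately show ?thesis by blast
  qed
qed

theorem theorem2p6:
  fixes p q :: nat
  assumes "p > 0" and "q > 0"
    and "2 < real p / real q" and "real p / real q < 4"
  shows "(\<forall>(G :: 'a pair_pre_digraph) (H :: 'b pair_pre_digraph).
            pair_graph G \<longrightarrow> pair_graph H \<longrightarrow> folds_to G H \<longrightarrow>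
            \<not> mixing p q H \<longrightarrow> \<not> mixing p q G) \<and>
         (p = 2 * q + 1 \<longrightarrow>
           (\<forall>G :: 'c pair_pre_digraph.
              pair_graph G \<longrightarrow> bipartite G \<longrightarrow> Digraph_Component.connected (with_proj G) \<longrightarrow>
              (mixing p q G \<longleftrightarrow> \<not> folds_to G (cycle_graph (4 * q + 2)))))"
proof -
  have "real (2 * q) < real p" "real p < real (4 * q)"
    using assms by (simp_all add: field_simps)
  then have pq: "2 * q < p" "p < 4 * q" by linarith+
  note mix = pair_graph.mixing_iff_potential[OF _ \<open>q > 0\<close> pq]
  show ?thesis
  proof (intro conjI allI impI)
    fix G :: "'a pair_pre_digraph" and H :: "'b pair_pre_digraph"
    assume "pair_graph G" "pair_graph H" "folds_to G H" "\<not> mixing p q H"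
    then show "\<not> mixing p q G" using mix folds_to_unliftable[OF _ \<open>q > 0\<close>] by metis
  next
    fix G :: "'c pair_pre_digraph"
    assume p: "p = 2 * q + 1" and G: "pair_graph G" "bipartite G" "Digraph_Component.connected (with_proj G)"
    let ?C = "cycle_graph (4 * q + 2)"
    have C: "pair_graph ?C" using \<open>q > 0\<close> by (intro pair_graph_cycle_graph) simp
    show "mixing p q G \<longleftrightarrow> \<not> folds_to G ?C"
    proof
      assume "mixing p q G"
      then show "\<not> folds_to G ?C"
        using mix[OF G(1)] folds_to_unliftable[OF _ \<open>q > 0\<close> G(1)] cycle_graph_unliftable[OF \<open>q > 0\<close>]
        unfolding p by blast
    next
      assume no: "\<not> folds_to G ?C"
      show "mixing p q G"
      proof (rule ccontr)
        assume "\<not> mixing p q G"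
        then obtain f where "unliftable (2 * q + 1) q G f" using mix[OF G(1)] p by blast
        then obtain h e where h: "fold_composition h G (graph_image e ?C)" and e: "inj_on e {0..<4 * q + 2}"
          using unliftable_imp_fold_cycle[OF \<open>q > 0\<close> G(1,2)]
            pair_graph.connected_neighbour_closed[OF G(1,3)] by blast
        have "digraph_iso (with_proj (graph_image h G)) (with_proj ?C)"
          unfolding fold_composition_image[OF h, symmetric]
          using C e by (intro digraph_iso_graph_image)
            (auto simp: pair_graph_def pair_digraph_def pair_fin_digraph_def)
        then show False using no h unfolding folds_to_def by blast
      qed
    qed
  qed
qed

end
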